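(* Let $u:X\to Y$, $v:X\to A$ and $w:Y\to A$ be $\omega$-functors with $w\circ u=v$, and suppose that $A$ is a $1$-category (i.e. a small category). If for every object $a$ of $A$ the induced $\omega$-functor \[ u/a : X/a \to Y/a \] is an equivalence of $\omega$-categories, then $u$ is also an equivalence of $\omega$-categories.
   Context: **$\omega$-categories.** "$\omega$-category" means small strict $\omega$-category, with strict $\omega$-functors as morphisms (category $\omega\mathbf{Cat}$). $C_n$ is the set of $n$-cells of $C$; $s(x),t(x)$ are source and target, $s_k(x),t_k(x)$ the iterated $k$-dimensional source and target (with $t_0(x)=x$ for a $0$-cell $x$); $x\ast_k y$ is defined for $n$-cells with $s_k(x)=t_k(y)$, $k<n$; $1_x$ is the unit on $x$. Two $n$-cells are parallel if $n=0$, or $n>0$ and they have the same source and the same target. A $1$-category is an $\omega$-category all of whose cells of dimension $>1$ are units; $1$-categories are identified with small categories. **Equivalences.** For $n$-cells $x,y$ of $C$, the relation $x\sim_\omega y$ is defined co-inductively: $x$ and $y$ are parallel and there are $(n+1)$-cells $r:x\to y$, $s:y\to x$ with $r\ast_n s\sim_\omega 1_y$ and $s\ast_n r\sim_\omega 1_x$. An $\omega$-functor $f:C\to D$ is an equivalence of $\omega$-categories if (i) for every $y\in D_0$ there is $x\in C_0$ with $f(x)\sim_\omega y$, and (ii) for all $n\geq 0$, all parallel $x,y\in C_n$ and all $\beta:f(x)\to f(y)$ in $D_{n+1}$ there is $\alpha:x\to y$ in $C_{n+1}$ with $f(\alpha)\sim_\omega\beta$. **Slices.** For an object $a$ of $A$,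 $A/a$ is the slice category with forgetful functor $\pi_a:A/a\to A$. For an $\omega$-functor $f:X\to A$, $X/a:=X\times_A A/a$ is the pullback of $f$ along $\pi_a$ in $\omega\mathbf{Cat}$; its $n$-cells are pairs $(x,p)$ with $x\in X_n$ and $p:f(t_0(x))\to a$ an arrow of $A$. Here $X/a$ is formed using $v$ and $Y/a$ using $w$, and $u/a$ is the $\omega$-functor $(x,p)\mapsto(u(x),p)$. *)

theory Defs
  imports Main
begin

section \<open>Strict omega-categories\<close>

text \<open>
  Every operation is indexed by a dimension, so cells of different dimensions need not be
  distinct elements of the carrier type.  The maps \<open>src C n\<close>, \<open>tgt C n\<close> lead from
  \<open>(n+1)\<close>-cells to \<open>n\<close>-cells, \<open>idt C n\<close> sends an \<open>n\<close>-cell to its unit, and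
  \<open>comp C n k x y\<close> is the composite of the \<open>n\<close>-cells \<open>x\<close>, \<open>y\<close> along a \<open>k\<close>-cell, in the order
  where the \<open>k\<close>-source of \<open>x\<close> is the \<open>k\<close>-target of \<open>y\<close>.
\<close>

record 'a ocat =
  cells :: "nat \<Rightarrow> 'a set"
  src :: "nat \<Rightarrow> 'a \<Rightarrow> 'a"
  tgt :: "nat \<Rightarrow> 'a \<Rightarrow> 'a"
  idt :: "nat \<Rightarrow> 'a \<Rightarrow> 'a"
  comp :: "nat \<Rightarrow> nat \<Rightarrow> 'a \<Rightarrow> 'a \<Rightarrow> 'a"

text \<open>
  \<open>srcs C k n x\<close> and \<open>tgts C k n x\<close> are the iterated source and target of dimension \<open>k \<le> n\<close> of
  the \<open>n\<close>-cell \<open>x\<close> (the cell itself if \<open>k = n\<close>); \<open>idts C k n x\<close> is the iterated unit of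
  dimension \<open>n \<ge> k\<close> on the \<open>k\<close>-cell \<open>x\<close>.
\<close>

primrec srcs :: "'a ocat \<Rightarrow> nat \<Rightarrow> nat \<Rightarrow> 'a \<Rightarrow> 'a" where
  "srcs C k 0 x = x"
| "srcs C k (Suc n) x = (if k \<le> n then srcs C k n (src C n x) else x)"

primrec tgts :: "'a ocat \<Rightarrow> nat \<Rightarrow> nat \<Rightarrow> 'a \<Rightarrow> 'a" where
  "tgts C k 0 x = x"
| "tgts C k (Suc n) x = (if k \<le> n then tgts C k n (tgt C n x) else x)"

primrec idts :: "'a ocat \<Rightarrow> nat \<Rightarrow> nat \<Rightarrow> 'a \<Rightarrow> 'a" where
  "idts C k 0 x = x"
| "idts C k (Suc n) x = (if k \<le> n then idt C n (idts C k n x) else x)"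

locale omega_category =
  fixes C :: "'a ocat"
  assumes src_cell: "x \<in> cells C (Suc n) \<Longrightarrow> src C n x \<in> cells C n"
    and tgt_cell: "x \<in> cells C (Suc n) \<Longrightarrow> tgt C n x \<in> cells C n"
    and idt_cell: "x \<in> cells C n \<Longrightarrow> idt C n x \<in> cells C (Suc n)"
    and comp_cell: "\<lbrakk>k < n; x \<in> cells C n; y \<in> cells C n; srcs C k n x = tgts C k n y\<rbrakk>
          \<Longrightarrow> comp C n k x y \<in> cells C n"
    and src_src: "x \<in> cells C (Suc (Suc n)) \<Longrightarrow> src C n (src C (Suc n) x) = src C n (tgt C (Suc n) x)"
    and tgt_tgt: "x \<in> cells C (Suc (Suc n)) \<Longrightarrow> tgt C n (src C (Suc n) x) = tgt C n (tgt C (Suc n) x)"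
    and src_idt: "x \<in> cells C n \<Longrightarrow> src C n (idt C n x) = x"
    and tgt_idt: "x \<in> cells C n \<Longrightarrow> tgt C n (idt C n x) = x"
    and src_comp_top: "\<lbrakk>x \<in> cells C (Suc n); y \<in> cells C (Suc n); src C n x = tgt C n y\<rbrakk>
          \<Longrightarrow> src C n (comp C (Suc n) n x y) = src C n y"
    and tgt_comp_top: "\<lbrakk>x \<in> cells C (Suc n); y \<in> cells C (Suc n); src C n x = tgt C n y\<rbrakk>
          \<Longrightarrow> tgt C n (comp C (Suc n) n x y) = tgt C n x"
    and src_comp: "\<lbrakk>k < n; x \<in> cells C (Suc n); y \<in> cells C (Suc n);
          srcs C k (Suc n) x = tgts C k (Suc n) y\<rbrakk>
          \<Longrightarrow> src C n (comp C (Suc n) k x y) = comp C n k (src C n x) (src C n y)"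
    and tgt_comp: "\<lbrakk>k < n; x \<in> cells C (Suc n); y \<in> cells C (Suc n);
          srcs C k (Suc n) x = tgts C k (Suc n) y\<rbrakk>
          \<Longrightarrow> tgt C n (comp C (Suc n) k x y) = comp C n k (tgt C n x) (tgt C n y)"
    and comp_assoc: "\<lbrakk>k < n; x \<in> cells C n; y \<in> cells C n; z \<in> cells C n;
          srcs C k n x = tgts C k n y; srcs C k n y = tgts C k n z\<rbrakk>
          \<Longrightarrow> comp C n k (comp C n k x y) z = comp C n k x (comp C n k y z)"
    and comp_idts_right: "\<lbrakk>k < n; x \<in> cells C n\<rbrakk>
          \<Longrightarrow> comp C n k x (idts C k n (srcs C k n x)) = x"
    and comp_idts_left: "\<lbrakk>k < n; x \<in> cells C n\<rbrakk>
          \<Longrightarrow> comp C n k (idts C k n (tgts C k n x)) x = x"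
    and idt_comp: "\<lbrakk>k < n; x \<in> cells C n; y \<in> cells C n; srcs C k n x = tgts C k n y\<rbrakk>
          \<Longrightarrow> idt C n (comp C n k x y) = comp C (Suc n) k (idt C n x) (idt C n y)"
    and interchange: "\<lbrakk>l < k; k < n; x \<in> cells C n; y \<in> cells C n; z \<in> cells C n; w \<in> cells C n;
          srcs C k n x = tgts C k n y; srcs C k n z = tgts C k n w; srcs C l n x = tgts C l n z\<rbrakk>
          \<Longrightarrow> comp C n l (comp C n k x y) (comp C n k z w)
            = comp C n k (comp C n l x z) (comp C n l y w)"

text \<open>A 1-category, i.e. a small category: all cells of dimension \<open>> 1\<close> are units.\<close>

locale one_category = omega_category C for C :: "'a ocat" +
  assumes unit_cells: "\<lbrakk>n \<ge> 1; x \<in> cells C (Suc n)\<rbrakk> \<Longrightarrow> \<exists>y \<in> cells C n. x = idt C n y"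

text \<open>The map \<open>f n\<close> is the action on \<open>n\<close>-cells.\<close>

locale omega_functor = C: omega_category C + D: omega_category D
  for C :: "'a ocat" and D :: "'b ocat" +
  fixes f :: "nat \<Rightarrow> 'a \<Rightarrow> 'b"
  assumes map_cell: "x \<in> cells C n \<Longrightarrow> f n x \<in> cells D n"
    and map_src: "x \<in> cells C (Suc n) \<Longrightarrow> f n (src C n x) = src D n (f (Suc n) x)"
    and map_tgt: "x \<in> cells C (Suc n) \<Longrightarrow> f n (tgt C n x) = tgt D n (f (Suc n) x)"
    and map_idt: "x \<in> cells C n \<Longrightarrow> f (Suc n) (idt C n x) = idt D n (f n x)"
    and map_comp: "\<lbrakk>k < n; x \<in> cells C n; y \<in> cells C n; srcs C k n x = tgts C k n y\<rbrakk>
          \<Longrightarrow> f n (comp C n k x y) = comp D n k (f n x) (f n y)"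


section \<open>Equivalences\<close>

definition parallel :: "'a ocat \<Rightarrow> nat \<Rightarrow> 'a \<Rightarrow> 'a \<Rightarrow> bool" where
  "parallel C n x y \<longleftrightarrow> x \<in> cells C n \<and> y \<in> cells C n \<and>
     (\<forall>m. n = Suc m \<longrightarrow> src C m x = src C m y \<and> tgt C m x = tgt C m y)"

definition hom :: "'a ocat \<Rightarrow> nat \<Rightarrow> 'a \<Rightarrow> 'a \<Rightarrow> 'a set" where
  "hom C n x y = {r \<in> cells C (Suc n). src C n r = x \<and> tgt C n r = y}"

coinductive omega_equiv :: "'a ocat \<Rightarrow> nat \<Rightarrow> 'a \<Rightarrow> 'a \<Rightarrow> bool" for C where
  omega_equivI: "\<lbrakk>parallel C n x y; r \<in> hom C n x y; s \<in> hom C n y x;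
     omega_equiv C (Suc n) (comp C (Suc n) n r s) (idt C n y);
     omega_equiv C (Suc n) (comp C (Suc n) n s r) (idt C n x)\<rbrakk>
   \<Longrightarrow> omega_equiv C n x y"

definition omega_equivalence :: "'a ocat \<Rightarrow> 'b ocat \<Rightarrow> (nat \<Rightarrow> 'a \<Rightarrow> 'b) \<Rightarrow> bool" where
  "omega_equivalence C D f \<longleftrightarrow> omega_functor C D f \<and>
     (\<forall>y \<in> cells D 0. \<exists>x \<in> cells C 0. omega_equiv D 0 (f 0 x) y) \<and>
     (\<forall>n x y \<beta>. parallel C n x y \<and> \<beta> \<in> hom D n (f n x) (f n y) \<longrightarrow>
        (\<exists>\<alpha> \<in> hom C n x y. omega_equiv D (Suc n) (f (Suc n) \<alpha>) \<beta>))"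


section \<open>Slices\<close>

text \<open>
  The slice category \<open>A/a\<close> of a 1-category \<open>A\<close>, as an omega-category.  An \<open>n\<close>-cell is encoded as
  an \<open>n\<close>-cell \<open>\<alpha>\<close> of \<open>A\<close> together with an arrow \<open>p\<close> from the 0-target of \<open>\<alpha>\<close> to \<open>a\<close>.  So an
  object is an arrow \<open>p : b \<rightarrow> a\<close> paired with \<open>b\<close>, and a 1-cell \<open>(\<alpha>, p)\<close> is the morphism
  \<open>\<alpha>\<close> from the object given by the composite of \<open>p\<close> with \<open>\<alpha>\<close> to the object given by \<open>p\<close>.
\<close>

definition slice :: "'a ocat \<Rightarrow> 'a \<Rightarrow> ('a \<times> 'a) ocat" where
  "slice A a = \<lparr>
     cells = (\<lambda>n. {(\<alpha>, p). \<alpha> \<in> cells A n \<and> p \<in> hom A 0 (tgts A 0 n \<alpha>) a}),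
     src = (\<lambda>n (\<alpha>, p). (src A n \<alpha>, if n = 0 then comp A 1 0 p \<alpha> else p)),
     tgt = (\<lambda>n (\<alpha>, p). (tgt A n \<alpha>, p)),
     idt = (\<lambda>n (\<alpha>, p). (idt A n \<alpha>, p)),
     comp = (\<lambda>n k (\<alpha>, p) (\<beta>, q). (comp A n k \<alpha> \<beta>, p)) \<rparr>"

definition slice_proj :: "nat \<Rightarrow> 'a \<times> 'a \<Rightarrow> 'a" where
  "slice_proj n = fst"

definition pullback ::
  "'x ocat \<Rightarrow> 'z ocat \<Rightarrow> (nat \<Rightarrow> 'x \<Rightarrow> 'a) \<Rightarrow> (nat \<Rightarrow> 'z \<Rightarrow> 'a) \<Rightarrow> ('x \<times> 'z) ocat" where
  "pullback X Z f g = \<lparr>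
     cells = (\<lambda>n. {(x, z). x \<in> cells X n \<and> z \<in> cells Z n \<and> f n x = g n z}),
     src = (\<lambda>n (x, z). (src X n x, src Z n z)),
     tgt = (\<lambda>n (x, z). (tgt X n x, tgt Z n z)),
     idt = (\<lambda>n (x, z). (idt X n x, idt Z n z)),
     comp = (\<lambda>n k (x, z) (x', z'). (comp X n k x x', comp Z n k z z')) \<rparr>"

definition over ::
  "'x ocat \<Rightarrow> 'a ocat \<Rightarrow> (nat \<Rightarrow> 'x \<Rightarrow> 'a) \<Rightarrow> 'a \<Rightarrow> ('x \<times> 'a \<times> 'a) ocat" where
  "over X A f a = pullback X (slice A a) f slice_proj"

definition over_map :: "(nat \<Rightarrow> 'x \<Rightarrow> 'y) \<Rightarrow> nat \<Rightarrow> 'x \<times> 'a \<times> 'a \<Rightarrow> 'y \<times> 'a \<times> 'a" where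
  "over_map u n = (\<lambda>(x, p). (u n x, p))"


section \<open>These constructions give omega-categories and omega-functors\<close>

context omega_category
begin

lemma srcs_cell: "k \<le> n \<Longrightarrow> x \<in> cells C n \<Longrightarrow> srcs C k n x \<in> cells C k"
  by (induction n arbitrary: x) (auto simp: le_Suc_eq src_cell)

lemma tgts_cell: "k \<le> n \<Longrightarrow> x \<in> cells C n \<Longrightarrow> tgts C k n x \<in> cells C k"
  by (induction n arbitrary: x) (auto simp: le_Suc_eq tgt_cell)

lemma idts_cell: "k \<le> n \<Longrightarrow> x \<in> cells C k \<Longrightarrow> idts C k n x \<in> cells C n"
  by (induction n) (auto simp: le_Suc_eq idt_cell)

lemma srcs_same [simp]: "srcs C n n x = x" by (cases n) auto
lemma tgts_same [simp]: "tgts C n n x = x" by (cases n) auto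
lemma idts_same [simp]: "idts C n n x = x" by (cases n) auto

lemma srcs_tgt: "k < n \<Longrightarrow> x \<in> cells C (Suc n) \<Longrightarrow> srcs C k n (src C n x) = srcs C k n (tgt C n x)"
  by (cases n) (auto simp: src_src)

lemma tgts_src: "k < n \<Longrightarrow> x \<in> cells C (Suc n) \<Longrightarrow> tgts C k n (src C n x) = tgts C k n (tgt C n x)"
  by (cases n) (auto simp: tgt_tgt)

lemma tgts_comp:
  "k < n \<Longrightarrow> x \<in> cells C n \<Longrightarrow> y \<in> cells C n \<Longrightarrow> srcs C k n x = tgts C k n y \<Longrightarrow>
   l \<le> k \<Longrightarrow> tgts C l n (comp C n k x y) = tgts C l n x"
proof (induction n arbitrary: x y)
  case 0
  then show ?case by simp
next
  case (Suc n)
  show ?case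
  proof (cases "k = n")
    case True
    then show ?thesis using Suc.prems by (simp add: tgt_comp_top)
  next
    case False
    then have "k < n" using Suc.prems by simp
    then show ?thesis
      using Suc.prems Suc.IH[of "tgt C n x" "tgt C n y"] by (simp add: tgt_comp tgt_cell srcs_tgt)
  qed
qed

end

context omega_functor
begin

lemma map_srcs: "k \<le> n \<Longrightarrow> x \<in> cells C n \<Longrightarrow> f k (srcs C k n x) = srcs D k n (f n x)"
  by (induction n arbitrary: x) (auto simp: le_Suc_eq C.src_cell map_src)

lemma map_tgts: "k \<le> n \<Longrightarrow> x \<in> cells C n \<Longrightarrow> f k (tgts C k n x) = tgts D k n (f n x)"
  by (induction n arbitrary: x) (auto simp: le_Suc_eq C.tgt_cell map_tgt)

end

lemma pullback_simps [simp]: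
  "(x, z) \<in> cells (pullback X Z f g) n \<longleftrightarrow> x \<in> cells X n \<and> z \<in> cells Z n \<and> f n x = g n z"
  "src (pullback X Z f g) n (x, z) = (src X n x, src Z n z)"
  "tgt (pullback X Z f g) n (x, z) = (tgt X n x, tgt Z n z)"
  "idt (pullback X Z f g) n (x, z) = (idt X n x, idt Z n z)"
  "comp (pullback X Z f g) n k (x, z) (x', z') = (comp X n k x x', comp Z n k z z')"
  by (simp_all add: pullback_def)

lemma pullback_iterated [simp]:
  "srcs (pullback X Z f g) k n (x, z) = (srcs X k n x, srcs Z k n z)"
  "tgts (pullback X Z f g) k n (x, z) = (tgts X k n x, tgts Z k n z)"
  "idts (pullback X Z f g) k n (x, z) = (idts X k n x, idts Z k n z)"
  by (induction n arbitrary: x z) auto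

lemma omega_category_pullback:
  assumes "omega_functor X A f" and "omega_functor Z A g"
  shows "omega_category (pullback X Z f g)"
proof -
  interpret f: omega_functor X A f by fact
  interpret g: omega_functor Z A g by fact
  show ?thesis
  proof (unfold_locales, goal_cases)
    case (1 x n) then show ?case
      by (cases x) (auto simp: f.C.src_cell g.C.src_cell f.map_src g.map_src)
  next
    case (2 x n) then show ?case
      by (cases x) (auto simp: f.C.tgt_cell g.C.tgt_cell f.map_tgt g.map_tgt)
  next
    case (3 x n) then show ?case
      by (cases x) (auto simp: f.C.idt_cell g.C.idt_cell f.map_idt g.map_idt)
  next
    case (4 k n x y) then show ?case
      by (cases x; cases y) (auto simp: f.C.comp_cell g.C.comp_cell f.map_comp g.map_comp)
  next
    case (5 x n) then show ?case by (cases x) (auto simp: f.C.src_src g.C.src_src)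
  next
    case (6 x n) then show ?case by (cases x) (auto simp: f.C.tgt_tgt g.C.tgt_tgt)
  next
    case (7 x n) then show ?case by (cases x) (auto simp: f.C.src_idt g.C.src_idt)
  next
    case (8 x n) then show ?case by (cases x) (auto simp: f.C.tgt_idt g.C.tgt_idt)
  next
    case (9 x n y) then show ?case
      by (cases x; cases y) (auto simp: f.C.src_comp_top g.C.src_comp_top)
  next
    case (10 x n y) then show ?case
      by (cases x; cases y) (auto simp: f.C.tgt_comp_top g.C.tgt_comp_top)
  next
    case (11 k n x y) then show ?case
      by (cases x; cases y) (auto simp: f.C.src_comp g.C.src_comp)
  next
    case (12 k n x y) then show ?case
      by (cases x; cases y) (auto simp: f.C.tgt_comp g.C.tgt_comp)
  next
    case (13 k n x y z) then show ?case
      by (cases x; cases y; cases z) (auto simp: f.C.comp_assoc g.C.comp_assoc)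
  next
    case (14 k n x) then show ?case
      by (cases x) (auto simp: f.C.comp_idts_right g.C.comp_idts_right)
  next
    case (15 k n x) then show ?case
      by (cases x) (auto simp: f.C.comp_idts_left g.C.comp_idts_left)
  next
    case (16 k n x y) then show ?case
      by (cases x; cases y) (auto simp: f.C.idt_comp g.C.idt_comp)
  next
    case (17 l k n x y z w) then show ?case
      by (cases x; cases y; cases z; cases w) (auto simp: f.C.interchange g.C.interchange)
  qed
qed

lemma slice_simps [simp]:
  "(\<alpha>, p) \<in> cells (slice A a) n \<longleftrightarrow> \<alpha> \<in> cells A n \<and> p \<in> hom A 0 (tgts A 0 n \<alpha>) a"
  "src (slice A a) n (\<alpha>, p) = (src A n \<alpha>, if n = 0 then comp A 1 0 p \<alpha> else p)"
  "tgt (slice A a) n (\<alpha>, p) = (tgt A n \<alpha>, p)"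
  "idt (slice A a) n (\<alpha>, p) = (idt A n \<alpha>, p)"
  "comp (slice A a) n k (\<alpha>, p) (\<beta>, q) = (comp A n k \<alpha> \<beta>, p)"
  by (simp_all add: slice_def)

lemma slice_iterated [simp]:
  "tgts (slice A a) k n (\<alpha>, p) = (tgts A k n \<alpha>, p)"
  "idts (slice A a) k n (\<alpha>, p) = (idts A k n \<alpha>, p)"
  by (induction n arbitrary: \<alpha> p) auto

lemma fst_srcs_slice [simp]: "fst (srcs (slice A a) k n z) = srcs A k n (fst z)"
  by (induction n arbitrary: z) (auto simp: slice_def split: prod.splits)

lemma srcs_slice:
  "0 < k \<Longrightarrow> srcs (slice A a) k n (\<alpha>, p) = (srcs A k n \<alpha>, p)"
  by (induction n arbitrary: \<alpha>) auto

lemma fst_idts_slice [simp]: "fst (idts (slice A a) k n z) = idts A k n (fst z)"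
  by (cases z) simp

lemma comp_slice: "comp (slice A a) n k z z' = (comp A n k (fst z) (fst z'), snd z)"
  by (cases z; cases z') simp

lemma srcs_slice_eqD:
  assumes "srcs (slice A a) k n (\<alpha>, p) = tgts (slice A a) k n (\<beta>, q)"
  shows "srcs A k n \<alpha> = tgts A k n \<beta>" and "0 < k \<Longrightarrow> p = q"
proof -
  show "srcs A k n \<alpha> = tgts A k n \<beta>"
    using fst_srcs_slice[of A a k n "(\<alpha>, p)"] unfolding assms by simp
  show "p = q" if "0 < k"
    using assms that by (simp add: srcs_slice)
qed

lemma one_category_slice:
  assumes "one_category A"
  shows "one_category (slice A a)"
proof -
  interpret A: one_category A by fact
  have hom0: "p \<in> hom A 0 b a \<longleftrightarrow> p \<in> cells A 1 \<and> src A 0 p = b \<and> tgt A 0 p = a" for p b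
    by (simp add: hom_def)
  have src_eq_tgt: "src A (Suc 0) x = tgt A (Suc 0) x" if "x \<in> cells A (Suc (Suc 0))" for x
    using A.unit_cells[of "Suc 0" x] that by (auto simp: A.src_idt A.tgt_idt)
  note eqD = srcs_slice_eqD
  show ?thesis
  proof (unfold_locales, goal_cases)
    case (1 x n)
    obtain \<alpha> p where x: "x = (\<alpha>, p)" by (cases x)
    show ?case
    proof (cases n)
      case 0
      with 1 x show ?thesis
        using A.src_comp_top[of p 0 \<alpha>] A.tgt_comp_top[of p 0 \<alpha>] A.comp_cell[of 0 1 p \<alpha>]
        by (auto simp: hom0 A.src_cell)
    next
      case (Suc m)
      with 1 x show ?thesis by (auto simp: A.src_cell A.tgt_tgt)
    qed
  next
    case (2 x n) then show ?case by (cases x) (auto simp: A.tgt_cell)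
  next
    case (3 x n) then show ?case by (cases x) (auto simp: A.idt_cell A.tgt_idt)
  next
    case (4 k n x y)
    obtain \<alpha> p \<beta> q where xy: "x = (\<alpha>, p)" "y = (\<beta>, q)" by (cases x; cases y)
    with 4 eqD(1)[of A a k n \<alpha> p \<beta> q] show ?case by (auto simp: A.comp_cell A.tgts_comp)
  next
    case (5 x n) then show ?case by (cases x) (auto simp: A.src_src src_eq_tgt)
  next
    case (6 x n) then show ?case by (cases x) (auto simp: A.tgt_tgt)
  next
    case (7 x n)
    obtain \<alpha> p where x: "x = (\<alpha>, p)" by (cases x)
    with 7 show ?case using A.comp_idts_right[of 0 1 p] by (auto simp: A.src_idt hom0)
  next
    case (8 x n) then show ?case by (cases x) (auto simp: A.tgt_idt)
  next
    case (9 x n y)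
    obtain \<alpha> p \<beta> q where xy: "x = (\<alpha>, p)" "y = (\<beta>, q)" by (cases x; cases y)
    with 9 show ?case
      using A.comp_assoc[of 0 1 p \<alpha> \<beta>] by (auto simp: A.src_comp_top hom0 split: if_splits)
  next
    case (10 x n y) then show ?case
      by (cases x; cases y) (auto simp: A.tgt_comp_top)
  next
    case (11 k n x y)
    obtain \<alpha> p \<beta> q where xy: "x = (\<alpha>, p)" "y = (\<beta>, q)" by (cases x; cases y)
    with 11 eqD(1)[of A a k "Suc n" \<alpha> p \<beta> q] show ?case by (auto simp: A.src_comp)
  next
    case (12 k n x y)
    obtain \<alpha> p \<beta> q where xy: "x = (\<alpha>, p)" "y = (\<beta>, q)" by (cases x; cases y)
    with 12 eqD(1)[of A a k "Suc n" \<alpha> p \<beta> q] show ?case by (auto simp: A.tgt_comp)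
  next
    case (13 k n x y z)
    obtain \<alpha> p \<beta> q \<gamma> r where xyz: "x = (\<alpha>, p)" "y = (\<beta>, q)" "z = (\<gamma>, r)"
      by (cases x; cases y; cases z)
    with 13 eqD(1)[of A a k n \<alpha> p \<beta> q] eqD(1)[of A a k n \<beta> q \<gamma> r] show ?case
      by (auto simp: A.comp_assoc)
  next
    case (14 k n x) then show ?case by (cases x) (auto simp: comp_slice A.comp_idts_right)
  next
    case (15 k n x) then show ?case by (cases x) (auto simp: A.comp_idts_left)
  next
    case (16 k n x y)
    obtain \<alpha> p \<beta> q where xy: "x = (\<alpha>, p)" "y = (\<beta>, q)" by (cases x; cases y)
    with 16 eqD(1)[of A a k n \<alpha> p \<beta> q] show ?case by (auto simp: A.idt_comp)
  next
    case (17 l k n x y z w)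
    obtain \<alpha> p \<beta> q \<gamma> r \<delta> t where xyzw: "x = (\<alpha>, p)" "y = (\<beta>, q)" "z = (\<gamma>, r)" "w = (\<delta>, t)"
      by (cases x; cases y; cases z; cases w)
    with 17 eqD(1)[of A a k n \<alpha> p \<beta> q] eqD(1)[of A a k n \<gamma> r \<delta> t] eqD(1)[of A a l n \<alpha> p \<gamma> r]
    show ?case by (auto simp: A.interchange)
  next
    case (18 n x)
    obtain \<alpha> p where x: "x = (\<alpha>, p)" by (cases x)
    with 18 obtain \<beta> where "\<beta> \<in> cells A n" "\<alpha> = idt A n \<beta>" using A.unit_cells[of n \<alpha>] by auto
    with 18 x show ?case by (intro bexI[of _ "(\<beta>, p)"]) (auto simp: A.tgt_idt)
  qed
qed

lemma omega_functor_slice_proj: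
  assumes "one_category A"
  shows "omega_functor (slice A a) A slice_proj"
proof -
  interpret A: one_category A by fact
  interpret S: one_category "slice A a" using assms by (rule one_category_slice)
  show ?thesis by unfold_locales (auto simp: slice_proj_def)
qed

lemma omega_category_over:
  assumes "one_category A" and "omega_functor X A f"
  shows "omega_category (over X A f a)"
  unfolding over_def
  by (rule omega_category_pullback[OF assms(2) omega_functor_slice_proj[OF assms(1)]])

lemma omega_functor_over_map:
  assumes "one_category A" and "omega_functor X Y u" and "omega_functor X A v" and "omega_functor Y A w"
    and "\<And>n x. x \<in> cells X n \<Longrightarrow> w n (u n x) = v n x"
  shows "omega_functor (over X A v a) (over Y A w a) (over_map u)"
proof -
  interpret u: omega_functor X Y u by fact
  interpret X: omega_category "over X A v a" using assms by (intro omega_category_over)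
  interpret Y: omega_category "over Y A w a" using assms by (intro omega_category_over)
  show ?thesis
    by unfold_locales
      (auto simp: over_def over_map_def assms(5) u.map_cell u.map_src u.map_tgt u.map_idt u.map_comp)
qed

text \<open>
  As an \<open>n\<close>-cell \<open>(\<alpha>, p)\<close> of \<open>A/a\<close> contains its image \<open>\<alpha>\<close> in \<open>A\<close>, an \<open>n\<close>-cell \<open>(x, (\<alpha>, p))\<close> of
  the pullback is determined by \<open>x\<close> and \<open>p\<close>.
\<close>

lemma bij_betw_cells_over:
  assumes "omega_functor X A f"
  shows "bij_betw (\<lambda>(x, p). (x, (f n x, p)))
    {(x, p). x \<in> cells X n \<and> p \<in> hom A 0 (f 0 (tgts X 0 n x)) a} (cells (over X A f a) n)"
proof -
  interpret f: omega_functor X A f by fact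
  show ?thesis
    by (rule bij_betw_byWitness[where f' = "\<lambda>(x, (\<alpha>, p)). (x, p)"])
      (auto simp: over_def slice_proj_def f.map_tgts f.map_cell)
qed

end

theory Submission
  imports Defs
begin

text \<open>
  The projection from \<open>Y/a\<close> to \<open>Y\<close>, being an omega-functor, preserves \<open>\<sim>\<^sub>\<omega>\<close>.  So it suffices to lift
  the data in \<open>Y\<close> to a slice, solve the problem there, and project back.  Every \<open>n\<close>-cell \<open>\<beta>\<close> of \<open>Y\<close>
  lifts to the slice over \<open>a = w(t\<^sub>0(\<beta>))\<close>, equipped with the unit on \<open>a\<close>.  As \<open>X/a\<close> is the pullback
  of \<open>Y/a\<close> along \<open>u\<close>, cells of \<open>X\<close> over the source and target of \<open>\<beta>\<close> lift compatibly; they stay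
  parallel because the source and target of the lift of \<open>\<beta>\<close> are parallel in \<open>Y/a\<close>.
\<close>

lemma (in omega_functor) map_hom:
  "r \<in> hom C n x y \<Longrightarrow> f (Suc n) r \<in> hom D n (f n x) (f n y)"
  using map_src[of r n] map_tgt[of r n] by (auto simp: hom_def map_cell)

lemma (in omega_functor) map_parallel:
  "parallel C n x y \<Longrightarrow> parallel D n (f n x) (f n y)"
  by (auto simp: parallel_def map_cell simp flip: map_src map_tgt)

lemma (in omega_functor) map_omega_equiv:
  assumes "omega_equiv C n x y"
  shows "omega_equiv D n (f n x) (f n y)"
proof -
  \<comment> \<open>The coinduction invariant consists of pairs of images under \<open>f\<close>;
    the dimension varies because the next stage compares cells one dimension higher.\<close>
  have "\<exists>x y. omega_equiv C n x y \<and> x' = f n x \<and> y' = f n y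
    \<Longrightarrow> omega_equiv D n x' y'" for n x' y'
  proof (coinduction arbitrary: n x' y')
    case omega_equiv
    then obtain x y where "omega_equiv C n x y" and x': "x' = f n x" and y': "y' = f n y"
      by blast
    then obtain r s where par: "parallel C n x y" and r: "r \<in> hom C n x y" and s: "s \<in> hom C n y x"
      and rs: "omega_equiv C (Suc n) (comp C (Suc n) n r s) (idt C n y)"
      and sr: "omega_equiv C (Suc n) (comp C (Suc n) n s r) (idt C n x)"
      by (auto elim: omega_equiv.cases)
    \<comment> \<open>As \<open>f\<close> preserves composites and units, the next stage again
      concerns pairs of images.\<close>
    have "f (Suc n) (comp C (Suc n) n r s) = comp D (Suc n) n (f (Suc n) r) (f (Suc n) s)"
      and "f (Suc n) (comp C (Suc n) n s r) = comp D (Suc n) n (f (Suc n) s) (f (Suc n) r)"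
      using r s by (auto simp: hom_def intro!: map_comp)
    moreover have "f (Suc n) (idt C n x) = idt D n x'" "f (Suc n) (idt C n y) = idt D n y'"
      using par by (auto simp: x' y' parallel_def map_idt)
    ultimately show ?case
      using map_parallel[OF par] map_hom[OF r] map_hom[OF s] rs sr unfolding x' y'
      by (intro exI[of _ n] exI[of _ "f n x"] exI[of _ "f n y"]
          exI[of _ "f (Suc n) r"] exI[of _ "f (Suc n) s"]) metis
  qed
  with assms show ?thesis by blast
qed

lemma omega_functor_pullback_fst:
  assumes "omega_functor X A f" and "omega_functor Z A g"
  shows "omega_functor (pullback X Z f g) X (\<lambda>n. fst)"
proof -
  interpret f: omega_functor X A f by fact
  interpret P: omega_category "pullback X Z f g" using assms by (rule omega_category_pullback)
  show ?thesis by unfold_locales auto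
qed

lemma (in one_category) slice_unit_cell:
  assumes "\<alpha> \<in> cells C n"
  shows "(\<alpha>, idt C 0 (tgts C 0 n \<alpha>)) \<in> cells (slice C (tgts C 0 n \<alpha>)) n"
  using assms tgts_cell[of 0 n \<alpha>] by (simp add: hom_def idt_cell src_idt tgt_idt)

theorem proposition9p2:
  fixes X :: "'x ocat" and Y :: "'y ocat" and A :: "'a ocat"
    and u :: "nat \<Rightarrow> 'x \<Rightarrow> 'y" and v :: "nat \<Rightarrow> 'x \<Rightarrow> 'a" and w :: "nat \<Rightarrow> 'y \<Rightarrow> 'a"
  assumes "omega_functor X Y u" and "omega_functor X A v" and "omega_functor Y A w"
    and "\<And>n x. x \<in> cells X n \<Longrightarrow> w n (u n x) = v n x"
    and "one_category A"
    and "\<And>a. a \<in> cells A 0 \<Longrightarrow> omega_equivalence (over X A v a) (over Y A w a) (over_map u)"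
  shows "omega_equivalence X Y u"
proof -
  interpret A: one_category A by fact
  interpret w: omega_functor Y A w by fact
  have project: "omega_equiv Y n (fst p) (fst q)" if "omega_equiv (over Y A w a) n p q" for a n p q
    using omega_functor.map_omega_equiv[OF omega_functor_pullback_fst] that
      assms(3) omega_functor_slice_proj[OF assms(5)] unfolding over_def by fast
  \<comment> \<open>The witness is \<open>z = (w n y, idt A 0 a)\<close> with \<open>a\<close> the
    0-target of \<open>w n y\<close>; the pullback condition forces the first component.\<close>
  have lift: "\<exists>a \<in> cells A 0. \<exists>z. (y, z) \<in> cells (over Y A w a) n" if "y \<in> cells Y n" for y n
    using A.slice_unit_cell[OF w.map_cell[OF that]] A.tgts_cell[of 0 n "w n y"] w.map_cell that
    by (auto simp: over_def slice_proj_def)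
  have "\<exists>x \<in> cells X 0. omega_equiv Y 0 (u 0 x) y" if y: "y \<in> cells Y 0" for y
  proof -
    obtain a z where "a \<in> cells A 0" and "(y, z) \<in> cells (over Y A w a) 0"
      using lift[OF y] by blast
    then obtain x where "x \<in> cells (over X A v a) 0"
      and "omega_equiv (over Y A w a) 0 (over_map u 0 x) (y, z)"
      using assms(6) unfolding omega_equivalence_def by blast
    then show ?thesis
      using project[of a 0 "over_map u 0 x" "(y, z)"]
      by (cases x) (auto simp: over_def over_map_def)
  qed
  moreover have "\<exists>\<alpha> \<in> hom X n x y. omega_equiv Y (Suc n) (u (Suc n) \<alpha>) \<beta>"
    if par: "parallel X n x y" and \<beta>: "\<beta> \<in> hom Y n (u n x) (u n y)" for n x y \<beta>
  proof -
    obtain a z where a: "a \<in> cells A 0" and z: "(\<beta>, z) \<in> cells (over Y A w a) (Suc n)"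
      using lift[of \<beta> "Suc n"] \<beta> by (auto simp: hom_def)
    interpret S: one_category "slice A a" using assms(5) by (rule one_category_slice)
    interpret W: omega_category "over Y A w a" using assms by (intro omega_category_over)
    \<comment> \<open>The slice components are taken from \<open>z\<close> rather than from fresh
      units: for \<open>n = 0\<close> the source of \<open>z\<close> carries the arrow of
      \<open>z\<close> composed with its underlying 1-cell.\<close>
    define x' where "x' = (x, src (slice A a) n z)"
    define y' where "y' = (y, tgt (slice A a) n z)"
    have \<beta>': "(\<beta>, z) \<in> hom (over Y A w a) n (over_map u n x') (over_map u n y')"
      using \<beta> z by (simp add: hom_def over_def over_map_def x'_def y'_def)
    \<comment> \<open>The source and target of \<open>(\<beta>, z)\<close> are cells of
      \<open>over Y A w a\<close> with first components \<open>u n x\<close> and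
      \<open>u n y\<close>; since w after u is v, their slice components lie over
      \<open>v n x\<close> and \<open>v n y\<close>.\<close>
    have "x' \<in> cells (over X A v a) n" "y' \<in> cells (over X A v a) n"
      using par \<beta> W.src_cell[OF z] W.tgt_cell[OF z] assms(4)
      by (auto simp: over_def x'_def y'_def parallel_def hom_def)
    moreover have "z \<in> cells (slice A a) (Suc n)"
      using z by (simp add: over_def)
    ultimately have "parallel (over X A v a) n x' y'"
      using par by (auto simp: parallel_def over_def x'_def y'_def S.src_src S.tgt_tgt)
    then obtain \<alpha> where "\<alpha> \<in> hom (over X A v a) n x' y'"
      and "omega_equiv (over Y A w a) (Suc n) (over_map u (Suc n) \<alpha>) (\<beta>, z)"
      using assms(6)[OF a] \<beta>' unfolding omega_equivalence_def by blast
    \<comment> \<open>The first component of \<open>\<alpha>\<close> is the required cell, since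
      \<open>over_map u\<close> acts on first components by \<open>u\<close>.\<close>
    then show ?thesis
      using project[of a "Suc n" "over_map u (Suc n) \<alpha>" "(\<beta>, z)"]
      by (cases \<alpha>) (auto simp: hom_def over_def over_map_def x'_def y'_def)
  qed
  ultimately show ?thesis
    unfolding omega_equivalence_def using assms(1) by blast
qed

end
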